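(* Let $1\le p\le\infty$ and let $f\in L_p[0,1]$ be a self-similar function of zero spectral order with parameters $n,a_k,d_k,\beta_k$. Let $\hat k$ be the unique index with $d_{\hat k}\neq0$, and let $\hat G_{\hat k}=G_{\hat k}$ (orientation preserving). Then $f$ is non-decreasing if and only if its parameters satisfy both of the following conditions: 1) $d_{\hat k}>0$; 2) if $1<\hat k<n$: $$\beta_1\le\dots\le\beta_{\hat k-1}\le d_{\hat k}\beta_1+\beta_{\hat k}\le d_{\hat k}\beta_n+\beta_{\hat k}\le\beta_{\hat k+1}\le\dots\le\beta_n;$$ if $\hat k=n$, condition 2) is replaced by $$\beta_1\le\dots\le\beta_{n-1}\le d_n\beta_1+\beta_n;$$ if $\hat k=1$, condition 2) is replaced by $$d_1\beta_n+\beta_1\le\beta_2\le\dots\le\beta_n.$$ For $f$ to be non-increasing, the inequalities in 2) must be reversed: $f$ is non-increasing if and only if condition 1) holds together with condition 2) in which all the inequalities are reversed.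
   Context: Similarity operators. Fix an integer $n>1$, real numbers $a_k>0$ ($k=1,\dots,n$) with $\sum_{k=1}^n a_k=1$, and real numbers $d_k,\beta_k$ ($k=1,\dots,n$). Put $\alpha_1=0$ and $\alpha_k=\sum_{l=1}^{k-1}a_l$ for $k=2,\dots,n+1$, so that $0=\alpha_1<\dots<\alpha_{n+1}=1$. For $f\in L_p[0,1]$ and $x\in[\alpha_k,\alpha_{k+1}]$ put $G_k(f)(x)=f\big((x-\alpha_k)/a_k\big)$ (orientation preserving) and $\tilde G_k(f)(x)=f\big((\alpha_{k+1}-x)/a_k\big)$ (orientation reversing); both are regarded as zero outside $[\alpha_k,\alpha_{k+1}]$. For each $k$ let $\hat G_k$ be either $G_k$ or $\tilde G_k$. The similarity operator $G:L_p[0,1]\to L_p[0,1]$ is $$G(f)=\sum_{k=1}^n\left\{\beta_k\,\chi_{(\alpha_k,\alpha_{k+1})}+d_k\,\hat G_k(f)\right\},$$ where $\chi$ denotes a characteristic function. Standing assumptions. $G$ is a contraction in $L_p[0,1]$: $\sum_{k=1}^n a_k|d_k|^p<1$ if $1\le p<\infty$, respectively $\max_k|d_k|<1$ if $p=\infty$. At least one of the $\beta_k$ is nonzero. A function $f\in L_p[0,1]$ is self-similar if $G(f)=f$ for such a $G$ (the fixed point is unique); the numbers $n,a_k,d_k,\beta_k$ are its parameters of self-similarity. It is called a self-similar function of zero spectral order if exactly one of the numbers $d_1,\dots,d_n$ is nonzero; the index of that number is denoted $\hat k$. It is further assumed throughout that $\beta_i\ne\beta_{i+1}$ whenever $1\le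 i<n$ and $i\ne\hat k$, $i+1\neq\hat k$ (otherwise the $i$-th and $(i+1)$-th pieces can be merged, reducing $n$ by one). An element of $L_p[0,1]$ is called non-decreasing (non-increasing) if it has a representative that is non-decreasing (non-increasing) on $(0,1)$.
   Formalization: It is additionally assumed that f is not a.e. constant when d_k̂ < 0; otherwise the claim fails, e.g. n=2, k̂=1, a=(1/2,1/2), d=(-1/2,0), β=(3,2) gives f=2, which is monotone although d_1<0. *)

theory Defs
  imports "HOL-Analysis.Analysis"
begin

text \<open>
  Elements of \<open>L\<^sub>p[0,1]\<close> are represented by functions \<open>real \<Rightarrow> real\<close>; only their restriction to
  \<open>[0,1]\<close> up to null sets matters, and equality in \<open>L\<^sub>p[0,1]\<close> is equality almost everywhere.
\<close>

abbreviation unit_leb :: "real measure" where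
  "unit_leb \<equiv> lebesgue_on {0..1}"

definition Lp_unit :: "ennreal \<Rightarrow> (real \<Rightarrow> real) set" where
  "Lp_unit p = {f \<in> borel_measurable unit_leb.
     if p = \<infinity> then \<exists>C. AE x in unit_leb. \<bar>f x\<bar> \<le> C
     else integrable unit_leb (\<lambda>x. \<bar>f x\<bar> powr enn2real p)}"

definition nondecreasing_Lp :: "(real \<Rightarrow> real) \<Rightarrow> bool" where
  "nondecreasing_Lp f \<longleftrightarrow>
     (\<exists>g. (AE x in unit_leb. f x = g x) \<and> mono_on {0<..<1} g)"

definition nonincreasing_Lp :: "(real \<Rightarrow> real) \<Rightarrow> bool" where
  "nonincreasing_Lp f \<longleftrightarrow>
     (\<exists>g. (AE x in unit_leb. f x = g x) \<and> antimono_on {0<..<1} g)"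

text \<open>
  Families \<open>a\<close>, \<open>d\<close>, \<open>\<beta>\<close> are indexed by \<open>1, \<dots>, n\<close>; values at other indices are irrelevant.
\<close>

definition node :: "(nat \<Rightarrow> real) \<Rightarrow> nat \<Rightarrow> real" where
  "node a k = (\<Sum>l = 1..<k. a l)"

definition piece_op :: "(nat \<Rightarrow> real) \<Rightarrow> nat \<Rightarrow> (real \<Rightarrow> real) \<Rightarrow> real \<Rightarrow> real" where
  "piece_op a k f x =
     (if x \<in> {node a k..node a (k + 1)} then f ((x - node a k) / a k) else 0)"

definition piece_op_rev :: "(nat \<Rightarrow> real) \<Rightarrow> nat \<Rightarrow> (real \<Rightarrow> real) \<Rightarrow> real \<Rightarrow> real" where
  "piece_op_rev a k f x =
     (if x \<in> {node a k..node a (k + 1)} then f ((node a (k + 1) - x) / a k) else 0)"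

text \<open>\<open>rv k\<close> selects the orientation reversing operator for the \<open>k\<close>-th piece.\<close>

definition similarity_op ::
  "nat \<Rightarrow> (nat \<Rightarrow> real) \<Rightarrow> (nat \<Rightarrow> real) \<Rightarrow> (nat \<Rightarrow> real) \<Rightarrow> (nat \<Rightarrow> bool)
    \<Rightarrow> (real \<Rightarrow> real) \<Rightarrow> real \<Rightarrow> real" where
  "similarity_op n a d \<beta> rv f x =
     (\<Sum>k = 1..n. \<beta> k * indicator {node a k<..<node a (k + 1)} x
        + d k * (if rv k then piece_op_rev a k f x else piece_op a k f x))"

definition contraction_params ::
  "ennreal \<Rightarrow> nat \<Rightarrow> (nat \<Rightarrow> real) \<Rightarrow> (nat \<Rightarrow> real) \<Rightarrow> bool" where
  "contraction_params p n a d \<longleftrightarrow>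
     (if p = \<infinity> then Max ((\<lambda>k. \<bar>d k\<bar>) ` {1..n}) < 1
      else (\<Sum>k = 1..n. a k * \<bar>d k\<bar> powr enn2real p) < 1)"

definition self_similar ::
  "ennreal \<Rightarrow> nat \<Rightarrow> (nat \<Rightarrow> real) \<Rightarrow> (nat \<Rightarrow> real) \<Rightarrow> (nat \<Rightarrow> real) \<Rightarrow> (nat \<Rightarrow> bool)
    \<Rightarrow> (real \<Rightarrow> real) \<Rightarrow> bool" where
  "self_similar p n a d \<beta> rv f \<longleftrightarrow>
     n > 1 \<and> (\<forall>k\<in>{1..n}. a k > 0) \<and> (\<Sum>k = 1..n. a k) = 1 \<and>
     contraction_params p n a d \<and> (\<exists>k\<in>{1..n}. \<beta> k \<noteq> 0) \<and>
     f \<in> Lp_unit p \<and> (AE x in unit_leb. similarity_op n a d \<beta> rv f x = f x)"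

text \<open>
  Zero spectral order with distinguished index \<open>kh\<close>, including the standing convention that no
  two adjacent constant pieces can be merged.

  These conditions do not exclude a.e. constant \<open>f\<close>: with \<open>n = 2\<close>, \<open>kh = 1\<close>, \<open>a = (1/2, 1/2)\<close>,
  \<open>d = (-1/2, 0)\<close>, \<open>\<beta> = (3, 2)\<close> the fixed point is the constant \<open>2\<close>, which is monotone although
  \<open>d 1 < 0\<close>.
\<close>

definition zero_spectral_order ::
  "nat \<Rightarrow> (nat \<Rightarrow> real) \<Rightarrow> (nat \<Rightarrow> real) \<Rightarrow> nat \<Rightarrow> bool" where
  "zero_spectral_order n d \<beta> kh \<longleftrightarrow>
     kh \<in> {1..n} \<and> d kh \<noteq> 0 \<and> (\<forall>k\<in>{1..n}. d k \<noteq> 0 \<longrightarrow> k = kh) \<and>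
     (\<forall>i. 1 \<le> i \<and> i < n \<and> i \<noteq> kh \<and> i + 1 \<noteq> kh \<longrightarrow> \<beta> i \<noteq> \<beta> (i + 1))"

text \<open>
  Condition 2) as a chain of comparisons for a relation \<open>R\<close>: \<open>(\<le>)\<close> gives the chain as displayed,
  \<open>(\<ge>)\<close> the chain with all inequalities reversed. Recall that \<open>[i..<j]\<close> excludes \<open>j\<close>.
\<close>

definition beta_chain ::
  "(real \<Rightarrow> real \<Rightarrow> bool) \<Rightarrow> nat \<Rightarrow> (nat \<Rightarrow> real) \<Rightarrow> (nat \<Rightarrow> real) \<Rightarrow> nat \<Rightarrow> bool" where
  "beta_chain R n d \<beta> kh \<longleftrightarrow> sorted_wrt R
     (if kh = n then map \<beta> [1..<n] @ [d n * \<beta> 1 + \<beta> n]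
      else if kh = 1 then [d 1 * \<beta> n + \<beta> 1] @ map \<beta> [2..<n + 1]
      else map \<beta> [1..<kh] @ [d kh * \<beta> 1 + \<beta> kh, d kh * \<beta> n + \<beta> kh]
             @ map \<beta> [kh + 1..<n + 1])"

end

theory Submission
  imports Defs
begin

text \<open>
  Let \<open>\<phi>\<close> map \<open>[0,1]\<close> affinely and increasingly onto the closure of the distinguished piece \<open>k\<close>, and
  put \<open>T v = d\<^sub>k v + \<beta>\<^sub>k\<close>. The fixed point equation says that \<open>f\<close> equals \<open>\<beta>\<^sub>i\<close> on every piece
  \<open>i \<noteq> k\<close>, and that \<open>f \<circ> \<phi> = T \<circ> f\<close>: on piece \<open>k\<close> the graph of \<open>f\<close> is an affine copy of the
  whole graph.

  This holds only almost everywhere. Removing from \<open>(0,1)\<close> the exceptional null set together with all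
  its images under the iterates of \<open>\<phi>\<close> leaves a set \<open>E\<close> of full measure that is stable under pulling
  points of piece \<open>k\<close> back by \<open>\<phi>\<close>, and on \<open>E\<close> both equations hold pointwise
  (\<open>obtain_pointwise_solution\<close>). A representative is monotone on \<open>(0,1)\<close> exactly when \<open>f\<close> is
  monotone on such a set, since a monotone function on a dense subset extends by suprema
  (\<open>mono_on_full_measure_imp_nondecreasing\<close>). It remains to compare \<open>f\<close> with the chain on \<open>E\<close>.

  Necessity: \<open>f\<close> takes the value \<open>\<beta>\<^sub>i\<close> on piece \<open>i\<close>, and \<open>T \<beta>\<^sub>1\<close>, \<open>T \<beta>\<^sub>n\<close> on the copies of the first
  and last piece inside piece \<open>k\<close>, so the chain lists values of \<open>f\<close> from left to right
  (\<open>chain_if_mono\<close>). If \<open>d\<^sub>k\<close> were negative, the copy of \<open>f\<close> on piece \<open>k\<close> would be both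
  non-decreasing and non-increasing, hence \<open>f\<close> would be constant (\<open>factor_pos_if_mono\<close>).

  Sufficiency: since \<open>\<phi>\<close> contracts, every point of \<open>E\<close> leaves piece \<open>k\<close> after finitely many
  pull-backs, which gives an induction principle (\<open>pull_induct\<close>). It yields first that \<open>f\<close> stays
  above \<open>\<beta>\<^sub>1\<close> if there are pieces to the left of \<open>k\<close> and below \<open>\<beta>\<^sub>n\<close> if there are pieces to the
  right, and then, with the chain bounding the copy on piece \<open>k\<close> against its neighbours, monotonicity
  (\<open>mono_on_if_chain\<close>).

  The non-increasing case is the non-decreasing one for \<open>- f\<close>, which solves the equation with
  \<open>- \<beta>\<close> in place of \<open>\<beta>\<close>.
\<close>

section \<open>Partition points\<close>

lemma node_less:
  assumes pos: "\<forall>k\<in>{1..n}. a k > 0" and "1 \<le> i" "i < j" "j \<le> n + 1"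
  shows "node a i < node a j"
proof -
  have "node a j = node a i + (\<Sum>l = i..<j. a l)"
    unfolding node_def using assms by (simp add: sum.atLeastLessThan_concat)
  moreover have "(\<Sum>l = i..<j. a l) > 0"
    using assms by (intro sum_pos) auto
  ultimately show ?thesis by simp
qed

lemma node_mono:
  assumes pos: "\<forall>k\<in>{1..n}. a k > 0" and "1 \<le> i" "i \<le> j" "j \<le> n + 1"
  shows "node a i \<le> node a j"
  using node_less[OF pos, of i j] assms by (cases "i = j") auto

lemma node_step: "1 \<le> k \<Longrightarrow> node a (k + 1) = node a k + a k"
  by (simp add: node_def)

lemma node_one: "node a 1 = 0"
  by (simp add: node_def)

lemma node_last: "node a (n + 1) = (\<Sum>k = 1..n. a k)"
  by (simp add: node_def atLeastLessThanSuc_atLeastAtMost)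

lemma part_less_one:
  fixes a :: "nat \<Rightarrow> real"
  assumes "n > 1" "k \<in> {1..n}" "\<forall>i\<in>{1..n}. a i > 0" "(\<Sum>i = 1..n. a i) = 1"
  shows "a k < 1"
proof -
  have "(if k = 1 then n else 1) \<in> {1..n} - {k}"
    using assms(1) by auto
  then have "{1..n} - {k} \<noteq> {}" by blast
  then have "(\<Sum>i \<in> {1..n} - {k}. a i) > 0"
    using assms(3) by (intro sum_pos) auto
  then show ?thesis
    using sum.remove[of "{1..n}" k a] assms by simp
qed

abbreviation piece :: "(nat \<Rightarrow> real) \<Rightarrow> nat \<Rightarrow> real set" where
  "piece a i \<equiv> {node a i<..<node a (i + 1)}"

lemma pieces_ordered:
  assumes "\<forall>k\<in>{1..n}. a k > 0" "i \<in> {1..n}" "j \<in> {1..n}" "i < j" "x \<in> piece a i" "y \<in> piece a j"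
  shows "x < y"
  using node_mono[OF assms(1), of "i + 1" j] assms by auto

lemma piece_cover:
  assumes "node a 1 < x" "x < node a (m + 1)" "\<forall>i\<in>{1..m}. x \<noteq> node a i"
  shows "\<exists>i\<in>{1..m}. x \<in> piece a i"
  using assms
proof (induction m)
  case (Suc m)
  show ?case
  proof (cases "x < node a (m + 1)")
    case True
    then obtain i where "i \<in> {1..m}" "x \<in> piece a i"
      using Suc by auto
    then have "i \<in> {1..Suc m}" by simp
    with \<open>x \<in> piece a i\<close> show ?thesis by blast
  next
    case False
    moreover have "x \<noteq> node a (m + 1)" using Suc.prems(3) by simp
    ultimately have "x \<in> piece a (Suc m)" using Suc.prems(2) by simp
    moreover have "Suc m \<in> {1..Suc m}" by simp
    ultimately show ?thesis by blast
  qed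
qed simp

text \<open>
  Only the interior of a piece is considered: at an interior partition point the closed pieces used by
  the transported copies overlap, while all the characteristic functions vanish.
\<close>
lemma similarity_op_on_piece:
  assumes pos: "\<forall>k\<in>{1..n}. a k > 0" and i: "i \<in> {1..n}" and k: "k \<in> {1..n}"
    and zero: "\<forall>j\<in>{1..n}. d j \<noteq> 0 \<longrightarrow> j = k" and rv: "\<not> rv k" and x: "x \<in> piece a i"
  shows "similarity_op n a d \<beta> rv f x =
    (if i = k then d k * f ((x - node a k) / a k) + \<beta> k else \<beta> i)"
proof -
  have other: "x \<notin> {node a j..node a (j + 1)}" if "j \<in> {1..n}" "j \<noteq> i" for j
  proof (cases "j < i")
    case True
    then show ?thesis using node_mono[OF pos, of "j + 1" i] i x by auto
  next
    case False
    then show ?thesis using node_mono[OF pos, of "i + 1" j] that x by auto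
  qed
  have "similarity_op n a d \<beta> rv f x =
      (\<Sum>j = 1..n. \<beta> j * indicator (piece a j) x)
      + (\<Sum>j = 1..n. d j * (if rv j then piece_op_rev a j f x else piece_op a j f x))"
    unfolding similarity_op_def by (rule sum.distrib)
  also have "(\<Sum>j = 1..n. \<beta> j * indicator (piece a j) x) = (\<Sum>j = 1..n. if j = i then \<beta> i else 0)"
    by (intro sum.cong) (use other x in \<open>force simp: indicator_def\<close>)+
  also have "\<dots> = \<beta> i" using i by simp
  also have "(\<Sum>j = 1..n. d j * (if rv j then piece_op_rev a j f x else piece_op a j f x))
      = (\<Sum>j = 1..n. if j = k then d k * piece_op a k f x else 0)"
    by (intro sum.cong) (use zero rv in auto)
  also have "\<dots> = d k * piece_op a k f x" using k by simp
  also have "piece_op a k f x = (if i = k then f ((x - node a k) / a k) else 0)"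
    unfolding piece_op_def using other[of k] x k by auto
  finally show ?thesis by simp
qed

section \<open>Null sets and monotone representatives\<close>

lemma AE_unit_leb_iff_negligible:
  "(AE x in unit_leb. P x) \<longleftrightarrow> negligible {x \<in> {0..1}. \<not> P x}"
proof -
  have "(AE x in unit_leb. P x) \<longleftrightarrow> (AE x in lebesgue. x \<in> {0..1} \<longrightarrow> P x)"
    by (rule AE_restrict_space_iff) simp
  also have "\<dots> \<longleftrightarrow> {x. \<not> (x \<in> {0..1} \<longrightarrow> P x)} \<in> null_sets lebesgue"
    by (simp only: completion.AE_iff_null_sets space_completion space_lborel space_borel UNIV_I simp_thms)
  also have "{x. \<not> (x \<in> {0..1} \<longrightarrow> P x)} = {x \<in> {0..1}. \<not> P x}"
    by blast
  finally show ?thesis by (simp only: negligible_iff_null_sets)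
qed

text \<open>
  The union of all forward images of \<open>N\<close> under the iterates of \<open>x \<mapsto> s + c x\<close> is null, and its
  complement is stable under the inverse map. Taking complements turns an equation that holds almost
  everywhere into one that may be iterated pointwise.
\<close>
lemma negligible_backward_invariant_hull:
  fixes N :: "real set"
  assumes N: "negligible N" and c: "c \<noteq> 0"
  obtains M where "negligible M" "N \<subseteq> M" "\<And>x. (x - s) / c \<in> M \<Longrightarrow> x \<in> M"
proof
  define \<phi> where "\<phi> = (\<lambda>x. s + c * x)"
  define M where "M = (\<Union>m. (\<phi> ^^ m) ` N)"
  have "negligible ((\<phi> ^^ m) ` N)" for m
  proof (induction m)
    case (Suc m)
    have "negligible (\<phi> ` ((\<phi> ^^ m) ` N))"
      by (rule negligible_differentiable_image_negligible[OF order_refl Suc])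
        (auto simp: \<phi>_def intro!: derivative_intros)
    then show ?case by (simp add: image_comp)
  qed (use N in auto)
  then show "negligible M" unfolding M_def by (intro negligible_countable_Union) auto
  show "N \<subseteq> M" unfolding M_def by (intro subsetI UN_I[of 0]) auto
  show "x \<in> M" if x: "(x - s) / c \<in> M" for x
  proof -
    obtain m y where y: "y \<in> N" "(x - s) / c = (\<phi> ^^ m) y"
      using x unfolding M_def by blast
    then have "x = (\<phi> ^^ Suc m) y" using c by (simp add: \<phi>_def field_simps)
    then show ?thesis using y(1) unfolding M_def by blast
  qed
qed

lemma full_measure_meets_interval:
  assumes "AE x in unit_leb. x \<in> E" "0 \<le> u" "u < v" "v \<le> 1"
  obtains x where "x \<in> E" "u < x" "x < v"
proof -
  have "\<not> negligible {u<..<v}"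
    using assms by (intro open_not_negligible) auto
  moreover have "negligible {x \<in> {0..1}. x \<notin> E}"
    using assms(1) by (simp add: AE_unit_leb_iff_negligible)
  ultimately have "\<not> {u<..<v} \<subseteq> {x \<in> {0..1}. x \<notin> E}"
    using negligible_subset by blast
  then show ?thesis using assms that by force
qed

text \<open>
  The representative is the supremum of the values of \<open>f\<close> on \<open>E\<close> to the left; points of \<open>E\<close> on both
  sides of each argument make this supremum finite and taken over a nonempty set.
\<close>
lemma mono_on_full_measure_imp_nondecreasing:
  assumes full: "AE x in unit_leb. x \<in> E" and E: "E \<subseteq> {0<..<1}" and mono: "mono_on E f"
  shows "nondecreasing_Lp f"
proof -
  define g where "g x = (SUP y \<in> E \<inter> {..x}. f y)" for x
  have bdd: "bdd_above (f ` (E \<inter> {..x}))" if x: "x < 1" "0 < x" for x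
  proof -
    obtain z where "z \<in> E" "x < z"
      using full_measure_meets_interval[OF full, of x 1] x by auto
    then show ?thesis
      by (intro bdd_aboveI[of _ "f z"]) (auto intro!: mono_onD[OF mono])
  qed
  have "mono_on {0<..<1} g"
  proof (rule mono_onI)
    fix x y :: real assume xy: "x \<in> {0<..<1}" "y \<in> {0<..<1}" "x \<le> y"
    obtain z where "z \<in> E" "z < x"
      using full_measure_meets_interval[OF full, of 0 x] xy by auto
    then show "g x \<le> g y"
      unfolding g_def using xy by (intro cSUP_subset_mono bdd) auto
  qed
  moreover have "f x = g x" if "x \<in> E" for x
  proof -
    have "Sup (f ` (E \<inter> {..x})) = f x"
      using that by (intro cSup_eq_maximum) (auto intro!: mono_onD[OF mono])
    then show ?thesis by (simp add: g_def)
  qed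
  then have "AE x in unit_leb. f x = g x"
    using full by (auto elim: AE_mp)
  ultimately show ?thesis unfolding nondecreasing_Lp_def by blast
qed

section \<open>The chain of inequalities\<close>

lemma sorted_wrt_map_upt:
  "sorted_wrt R (map \<beta> [l..<m]) \<longleftrightarrow> (\<forall>i j. l \<le> i \<longrightarrow> i < j \<longrightarrow> j < m \<longrightarrow> R (\<beta> i) (\<beta> j))"
  by (induction m) (auto simp: sorted_wrt_append less_Suc_eq)

text \<open>
  With the index conditions vacuous on an empty side, one description covers all three positions of
  \<open>k\<close>. Comparisons across piece \<open>k\<close> are omitted because they follow by transitivity.
\<close>
lemma beta_chain_le_iff:
  fixes \<beta> d :: "nat \<Rightarrow> real"
  assumes "n > 1" "k \<in> {1..n}"
  shows "beta_chain (\<le>) n d \<beta> k \<longleftrightarrow>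
    (\<forall>i j. 1 \<le> i \<longrightarrow> i < j \<longrightarrow> j < k \<longrightarrow> \<beta> i \<le> \<beta> j) \<and>
    (\<forall>i j. k < i \<longrightarrow> i < j \<longrightarrow> j \<le> n \<longrightarrow> \<beta> i \<le> \<beta> j) \<and>
    (\<forall>i. 1 \<le> i \<longrightarrow> i < k \<longrightarrow> \<beta> i \<le> d k * \<beta> 1 + \<beta> k) \<and>
    (\<forall>j. k < j \<longrightarrow> j \<le> n \<longrightarrow> d k * \<beta> n + \<beta> k \<le> \<beta> j) \<and>
    (1 < k \<and> k < n \<longrightarrow> d k * \<beta> 1 + \<beta> k \<le> d k * \<beta> n + \<beta> k)"
proof -
  consider "k = n" | "k = 1" "k \<noteq> n" | "1 < k" "k < n" using assms by fastforce
  then show ?thesis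
  proof cases
    case 1
    then show ?thesis using assms
      by (auto simp: beta_chain_def sorted_wrt_append sorted_wrt_map_upt simp del: upt_Suc)
  next
    case 2
    then show ?thesis using assms
      by (auto simp: beta_chain_def sorted_wrt_append sorted_wrt_map_upt Suc_le_eq less_Suc_eq_le
        numeral_2_eq_2 simp del: upt_Suc)
  next
    case 3
    show ?thesis (is "_ \<longleftrightarrow> ?pairs")
    proof
      assume "beta_chain (\<le>) n d \<beta> k"
      with 3 show ?pairs
        by (auto simp: beta_chain_def sorted_wrt_append sorted_wrt_map_upt Suc_le_eq
          less_Suc_eq_le simp del: upt_Suc)
    next
      assume pairs: ?pairs
      then have left: "\<beta> i \<le> d k * \<beta> n + \<beta> k" if "1 \<le> i" "i < k" for i
        using that 3 by force
      have right: "d k * \<beta> 1 + \<beta> k \<le> \<beta> j" if "k < j" "j \<le> n" for j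
        using pairs that 3 by force
      have "\<beta> i \<le> \<beta> j" if "1 \<le> i" "i < k" "k < j" "j \<le> n" for i j
        using pairs right[of j] that by force
      with pairs left right 3 show "beta_chain (\<le>) n d \<beta> k"
        by (auto simp: beta_chain_def sorted_wrt_append sorted_wrt_map_upt Suc_le_eq
          less_Suc_eq_le simp del: upt_Suc)
    qed
  qed
qed

lemma beta_chain_ge_iff_uminus:
  fixes \<beta> d :: "nat \<Rightarrow> real"
  shows "beta_chain (\<ge>) n d \<beta> k \<longleftrightarrow> beta_chain (\<le>) n d (\<lambda>i. - \<beta> i) k"
proof -
  have "sorted_wrt (\<ge>) xs \<longleftrightarrow> sorted_wrt (\<le>) (map uminus xs)" for xs :: "real list"
    by (simp add: sorted_wrt_map)
  then show ?thesis
    unfolding beta_chain_def by (simp add: comp_def del: upt_Suc)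
qed

section \<open>Pointwise solutions on a set of full measure\<close>

text \<open>
  The set \<open>E\<close> avoids the partition points and is stable under pulling back from piece \<open>k\<close>. It also
  avoids \<open>node a k / (1 - a k)\<close>, the fixed point of \<open>y \<mapsto> node a k + a k * y\<close> and hence the only point
  that can be pulled back forever.
\<close>
locale pointwise_solution =
  fixes n k :: nat and a d \<beta> :: "nat \<Rightarrow> real" and f :: "real \<Rightarrow> real" and E :: "real set"
  assumes n: "n > 1" and k: "k \<in> {1..n}"
    and pos: "\<forall>i\<in>{1..n}. a i > 0" and total: "(\<Sum>i = 1..n. a i) = 1"
    and E: "E \<subseteq> {0<..<1}" and full: "AE x in unit_leb. x \<in> E"
    and cover: "x \<in> E \<Longrightarrow> \<exists>i\<in>{1..n}. x \<in> piece a i"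
    and outside_value: "x \<in> E \<Longrightarrow> i \<in> {1..n} \<Longrightarrow> i \<noteq> k \<Longrightarrow> x \<in> piece a i \<Longrightarrow> f x = \<beta> i"
    and pull_back_mem: "x \<in> E \<Longrightarrow> x \<in> piece a k \<Longrightarrow> (x - node a k) / a k \<in> E"
    and scaling: "x \<in> E \<Longrightarrow> x \<in> piece a k \<Longrightarrow> f x = d k * f ((x - node a k) / a k) + \<beta> k"
    and not_fixed: "x \<in> E \<Longrightarrow> x \<noteq> node a k / (1 - a k)"
begin

lemma node_bounds: "1 \<le> i \<Longrightarrow> i \<le> n + 1 \<Longrightarrow> 0 \<le> node a i \<and> node a i \<le> 1"
  using node_mono[OF pos, of 1 i] node_mono[OF pos, of i "n + 1"] total
  by (simp only: node_one node_last)

lemma piece_nonempty: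
  assumes "i \<in> {1..n}"
  obtains x where "x \<in> E" "x \<in> piece a i"
proof -
  obtain x where "x \<in> E" "node a i < x" "x < node a (i + 1)"
    using full_measure_meets_interval[OF full, of "node a i" "node a (i + 1)"]
      node_bounds[of i] node_bounds[of "i + 1"] node_less[OF pos, of i "i + 1"] assms by auto
  then show ?thesis using that by auto
qed

lemma ratio_less_one: "0 < a k" "a k < 1"
  using pos k part_less_one[OF n k pos total] by auto

lemma image_in_piece:
  assumes "0 < y" "y < 1"
  shows "node a k + a k * y \<in> piece a k"
  using assms ratio_less_one k node_step[of k a] by (auto)

lemma pull_back_le_iff: "(x - node a k) / a k \<le> (y - node a k) / a k \<longleftrightarrow> x \<le> y"
  using ratio_less_one by (simp add: divide_le_cancel)

text \<open>
  Each pull-back multiplies the distance to \<open>z = node a k / (1 - a k)\<close> by \<open>1 / a k > 1\<close>, and within \<open>(0,1)\<close>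
  that distance stays below \<open>1\<close>. So a point at distance at least \<open>a k ^ m\<close> from \<open>z\<close> reaches another
  piece in fewer than \<open>m\<close> pull-backs.
\<close>
lemma pull_induct [consumes 1, case_names const pull]:
  assumes "x \<in> E"
    and const': "\<And>x i. x \<in> E \<Longrightarrow> i \<in> {1..n} \<Longrightarrow> i \<noteq> k \<Longrightarrow> x \<in> piece a i \<Longrightarrow> P x"
    and pull': "\<And>x. x \<in> E \<Longrightarrow> x \<in> piece a k \<Longrightarrow> P ((x - node a k) / a k) \<Longrightarrow> P x"
  shows "P x"
proof -
  define z where "z = node a k / (1 - a k)"
  have z: "z - node a k = a k * z"
    using ratio_less_one by (simp add: z_def field_simps)
  have "node a k + a k \<le> 1" "0 \<le> node a k"
    using node_bounds[of k] node_bounds[of "k + 1"] node_step[of k a] k by auto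
  then have z01: "0 \<le> z" "z \<le> 1"
    using ratio_less_one by (auto simp: z_def field_simps)
  have step: "(x - node a k) / a k - z = (x - z) / a k" for x
    using ratio_less_one z by (simp add: field_simps)
  have *: "P x" if "x \<in> E" "a k ^ m \<le> \<bar>x - z\<bar>" for x m
    using that
  proof (induction m arbitrary: x)
    case 0
    then have "0 < x" "x < 1" using E by auto
    with z01 0(2) show ?case by simp
  next
    case (Suc m)
    obtain i where i: "i \<in> {1..n}" "x \<in> piece a i" using cover Suc.prems by blast
    show ?case
    proof (cases "i = k")
      case True
      have "a k ^ m \<le> \<bar>(x - node a k) / a k - z\<bar>"
        using Suc.prems(2) ratio_less_one by (simp add: step field_simps)
      with Suc True i pull_back_mem pull' show ?thesis by auto
    next
      case False
      with Suc.prems i const' show ?thesis by blast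
    qed
  qed
  have "x \<noteq> z"
    using not_fixed[OF assms(1)] by (simp add: z_def)
  then obtain m where "a k ^ m < \<bar>x - z\<bar>"
    using real_arch_pow_inv[of "\<bar>x - z\<bar>" "a k"] ratio_less_one by auto
  then show ?thesis using *[of x m] assms(1) by simp
qed

text \<open>
  A point of piece \<open>k\<close> is compared with one of another piece through the bounds \<open>\<beta>\<^sub>1\<close> and \<open>\<beta>\<^sub>n\<close>
  at its pull-back, and two points in piece \<open>k\<close> by pulling both back, so that induction on the left
  point alone suffices. The bound by \<open>\<beta>\<^sub>1\<close> requires a piece to the left of \<open>k\<close>, the one by \<open>\<beta>\<^sub>n\<close> a
  piece to the right.
\<close>
lemma mono_on_if_chain:
  assumes d: "d k > 0" and chain: "beta_chain (\<le>) n d \<beta> k"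
  shows "mono_on E f"
proof -
  note C = chain[unfolded beta_chain_le_iff[OF n k]]
  have left: "\<And>i j. 1 \<le> i \<Longrightarrow> i \<le> j \<Longrightarrow> j < k \<Longrightarrow> \<beta> i \<le> \<beta> j"
    and right: "\<And>i j. k < i \<Longrightarrow> i \<le> j \<Longrightarrow> j \<le> n \<Longrightarrow> \<beta> i \<le> \<beta> j"
    and left_k: "\<And>i. 1 \<le> i \<Longrightarrow> i < k \<Longrightarrow> \<beta> i \<le> d k * \<beta> 1 + \<beta> k"
    and k_right: "\<And>j. k < j \<Longrightarrow> j \<le> n \<Longrightarrow> d k * \<beta> n + \<beta> k \<le> \<beta> j"
    and middle: "1 < k \<Longrightarrow> k < n \<Longrightarrow> d k * \<beta> 1 + \<beta> k \<le> d k * \<beta> n + \<beta> k"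
    using C by (auto simp: le_less)
  have left_right: "\<beta> i \<le> \<beta> j" if "1 \<le> i" "i < k" "k < j" "j \<le> n" for i j
    using left_k[of i] middle k_right[of j] that by linarith
  have lower: "\<beta> 1 \<le> f x" if "x \<in> E" "1 < k" for x
    using that(1)
  proof (induction rule: pull_induct)
    case (const x i)
    then show ?case
      using outside_value[of x i] left[of 1 i] left_right[of 1 i] that
      by (cases "i < k") auto
  next
    case (pull x)
    then have "d k * \<beta> 1 + \<beta> k \<le> f x" using scaling[of x] d by simp
    with left_k[of 1] that show ?case by simp
  qed
  have upper: "f x \<le> \<beta> n" if "x \<in> E" "k < n" for x
    using that(1)
  proof (induction rule: pull_induct)
    case (const x i)
    then show ?case
      using outside_value[of x i] right[of i n] left_right[of i n] that
      by (cases "i < k") auto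
  next
    case (pull x)
    then have "f x \<le> d k * \<beta> n + \<beta> k" using scaling[of x] d by simp
    with k_right[of n] that show ?case by simp
  qed
  have outside: "f x \<le> f y"
    if x: "x \<in> E" "i \<in> {1..n}" "x \<in> piece a i" and y: "y \<in> E" "j \<in> {1..n}" "y \<in> piece a j"
      and ij: "i \<le> j" "i \<noteq> k \<or> j \<noteq> k" for x y i j
  proof -
    consider "i < k" "j < k" | "i < k" "j = k" | "i < k" "k < j" | "i = k" "k < j" | "k < i" "k < j"
      using ij by linarith
    then show ?thesis
    proof cases
      case 2
      have "d k * \<beta> 1 + \<beta> k \<le> f y"
        using lower[OF pull_back_mem[of y]] scaling[of y] y x 2 d by auto
      with left_k[of i] outside_value[of x i] x 2 show ?thesis by auto
    next
      case 4
      have "f x \<le> d k * \<beta> n + \<beta> k"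
        using upper[OF pull_back_mem[of x]] scaling[of x] x y 4 d by auto
      with k_right[of j] outside_value[of y j] y 4 show ?thesis by auto
    qed (use outside_value[of x i] outside_value[of y j] x y ij left right left_right in auto)
  qed
  have "\<forall>y\<in>E. x \<le> y \<longrightarrow> f x \<le> f y" if "x \<in> E" for x
    using that
  proof (induction rule: pull_induct)
    case (const x i)
    show ?case
    proof (intro ballI impI)
      fix y assume y: "y \<in> E" "x \<le> y"
      obtain j where j: "j \<in> {1..n}" "y \<in> piece a j" using cover y by blast
      have "i \<le> j" using pieces_ordered[OF pos, of j i y x] j const y by force
      with outside j const y show "f x \<le> f y" by blast
    qed
  next
    case (pull x)
    show ?case
    proof (intro ballI impI)
      fix y assume y: "y \<in> E" "x \<le> y"
      obtain j where j: "j \<in> {1..n}" "y \<in> piece a j" using cover y by blast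
      have "k \<le> j" using pieces_ordered[OF pos, of j k y x] j k pull y by force
      show "f x \<le> f y"
      proof (cases "j = k")
        case True
        then have "f ((x - node a k) / a k) \<le> f ((y - node a k) / a k)"
          using pull j y pull_back_mem[of y] pull_back_le_iff[of x y] by auto
        then show ?thesis using scaling[of x] scaling[of y] pull True j y d by simp
      next
        case False
        then show ?thesis using outside[of x k y j] pull j y k \<open>k \<le> j\<close> by auto
      qed
    qed
  qed
  then show ?thesis by (auto intro: mono_onI)
qed

text \<open>
  For \<open>d k < 0\<close> the copy of \<open>f\<close> on piece \<open>k\<close> runs against \<open>f\<close> itself, so monotonicity on both scales
  forces equality of any two values.
\<close>
lemma factor_pos_if_mono:
  assumes mono: "mono_on E f" and d: "d k \<noteq> 0"
    and nonconst: "d k < 0 \<longrightarrow> \<not> (\<exists>c. AE x in unit_leb. f x = c)"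
  shows "d k > 0"
proof (rule ccontr)
  assume "\<not> d k > 0"
  with d have neg: "d k < 0" by simp
  define \<phi> where "\<phi> = (\<lambda>y. node a k + a k * y)"
  have \<phi>: "\<phi> y \<in> piece a k" "(\<phi> y - node a k) / a k = y" if "y \<in> E" for y
    using that E image_in_piece[of y] ratio_less_one by (auto simp: \<phi>_def)
  \<comment> \<open>\<open>E\<close> is stable under pull-back only, so points whose image leaves \<open>E\<close> must be discarded as well.\<close>
  define N where "N = {x \<in> {0..1}. x \<notin> E}"
  have N: "negligible N" using full by (simp add: N_def AE_unit_leb_iff_negligible)
  have "negligible ((\<lambda>x. (x - node a k) / a k) ` N)"
    using ratio_less_one by (intro negligible_differentiable_image_negligible[OF order_refl N])
      (auto simp: divide_inverse differentiable_on_def intro!: derivative_intros)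
  then have "negligible (N \<union> (\<lambda>x. (x - node a k) / a k) ` N)"
    using N by simp
  moreover have "{x \<in> {0..1}. \<not> (x \<in> E \<and> \<phi> x \<in> E)} \<subseteq> N \<union> (\<lambda>x. (x - node a k) / a k) ` N"
  proof
    fix x assume x: "x \<in> {x \<in> {0..1}. \<not> (x \<in> E \<and> \<phi> x \<in> E)}"
    show "x \<in> N \<union> (\<lambda>x. (x - node a k) / a k) ` N"
    proof (cases "x \<in> E")
      case True
      with x have "\<phi> x \<notin> E" by simp
      moreover have "\<phi> x \<in> {0..1}"
        using \<phi>(1)[OF True] node_bounds[of k] node_bounds[of "k + 1"] k by auto
      ultimately have "\<phi> x \<in> N" by (simp add: N_def)
      with \<phi>(2)[OF True] show ?thesis by force
    qed (use x in \<open>auto simp: N_def\<close>)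
  qed
  ultimately have full': "AE x in unit_leb. x \<in> E \<and> \<phi> x \<in> E"
    unfolding AE_unit_leb_iff_negligible by (rule negligible_subset)
  have eq: "f u = f v" if "u \<in> E" "\<phi> u \<in> E" "v \<in> E" "\<phi> v \<in> E" "u \<le> v" for u v
  proof -
    have "f (\<phi> u) \<le> f (\<phi> v)"
      using that ratio_less_one by (intro mono_onD[OF mono]) (auto simp: \<phi>_def)
    then have "d k * f u \<le> d k * f v"
      using scaling[of "\<phi> u"] scaling[of "\<phi> v"] \<phi> that by simp
    then have "f v \<le> f u" using neg by simp
    moreover have "f u \<le> f v" using mono_onD[OF mono] that by blast
    ultimately show ?thesis by simp
  qed
  have "AE x in unit_leb. x \<in> {x. x \<in> E \<and> \<phi> x \<in> E}"
    using full' by simp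
  then obtain u where "u \<in> {x. x \<in> E \<and> \<phi> x \<in> E}"
    using full_measure_meets_interval order_refl zero_less_one by metis
  then have u: "u \<in> E" "\<phi> u \<in> E" by blast+
  have "f x = f u" if "x \<in> E \<and> \<phi> x \<in> E" for x
    using eq u that linear[of x u] by metis
  with full' have "AE x in unit_leb. f x = f u"
    by (rule eventually_mono)
  with nonconst neg show False by blast
qed

text \<open>
  Every entry of the chain is a value of \<open>f\<close> on \<open>E\<close>: the outer ones are taken on the pieces
  themselves, the middle ones on the copies of the first and last piece inside piece \<open>k\<close>.
\<close>
lemma chain_if_mono:
  assumes mono: "mono_on E f"
  shows "beta_chain (\<le>) n d \<beta> k"
proof -
  have less: "f x \<le> f y" if "x \<in> E" "x \<in> piece a i" "y \<in> E" "y \<in> piece a j"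
    "i \<in> {1..n}" "j \<in> {1..n}" "i < j" for x y i j
    using pieces_ordered[OF pos, of i j x y] that by (intro mono_onD[OF mono]) auto
  have copy: "\<exists>x\<in>E. x \<in> piece a k \<and> (x - node a k) / a k \<in> piece a i \<and>
      f x = d k * \<beta> i + \<beta> k" if i: "i \<in> {1..n}" "i \<noteq> k" for i
  proof -
    have b: "0 \<le> node a i" "node a i < node a (i + 1)" "node a (i + 1) \<le> 1"
      using node_bounds[of i] node_bounds[of "i + 1"] node_less[OF pos, of i "i + 1"] i by auto
    have s: "0 \<le> node a k" "node a k + a k \<le> 1"
      using node_bounds[of k] node_bounds[of "k + 1"] node_step[of k a] k by auto
    have le: "a k * node a (i + 1) \<le> a k"
      using b ratio_less_one by (simp add: mult_left_le)
    have "node a k + a k * node a i < node a k + a k * node a (i + 1)"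
      using b ratio_less_one by simp
    moreover have "0 \<le> node a k + a k * node a i" using b s ratio_less_one by simp
    moreover have "node a k + a k * node a (i + 1) \<le> 1" using le s by linarith
    ultimately obtain x where x: "x \<in> E" "node a k + a k * node a i < x"
       "x < node a k + a k * node a (i + 1)"
      using full_measure_meets_interval[OF full] by metis
    then have y: "(x - node a k) / a k \<in> piece a i"
      using ratio_less_one by (simp add: field_simps)
    have "x \<in> piece a k"
    proof -
      have "0 \<le> a k * node a i" using b ratio_less_one by simp
      then show ?thesis using x le node_step[of k a] k by (auto)
    qed
    with x y i show ?thesis using pull_back_mem scaling outside_value by metis
  qed
  have val: "\<exists>x\<in>E. x \<in> piece a i \<and> f x = \<beta> i" if "i \<in> {1..n}" "i \<noteq> k" for i
    using piece_nonempty[OF that(1)] outside_value that by metis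
  have "\<beta> i \<le> \<beta> j" if "i \<in> {1..n}" "i \<noteq> k" "j \<in> {1..n}" "j \<noteq> k" "i < j" for i j
    using val[of i] val[of j] less that by metis
  moreover have "\<beta> i \<le> d k * \<beta> 1 + \<beta> k" if "1 \<le> i" "i < k" for i
    using val[of i] copy[of 1] less[of _ i _ k] that k by force
  moreover have "d k * \<beta> n + \<beta> k \<le> \<beta> j" if "k < j" "j \<le> n" for j
    using val[of j] copy[of n] less[of _ k _ j] that k by force
  moreover have "d k * \<beta> 1 + \<beta> k \<le> d k * \<beta> n + \<beta> k" if k': "1 < k" "k < n"
  proof -
    obtain x where x: "x \<in> E" "x \<in> piece a k" "(x - node a k) / a k \<in> piece a 1"
      "f x = d k * \<beta> 1 + \<beta> k" using copy[of 1] k' by auto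
    obtain y where y: "y \<in> E" "y \<in> piece a k" "(y - node a k) / a k \<in> piece a n"
      "f y = d k * \<beta> n + \<beta> k" using copy[of n] k' by auto
    have "x \<le> y"
      using pieces_ordered[OF pos _ _ _ x(3) y(3)] n pull_back_le_iff[of x y] by auto
    with mono_onD[OF mono x(1) y(1)] x y show ?thesis by simp
  qed
  ultimately show ?thesis
    unfolding beta_chain_le_iff[OF n k] using n k by auto
qed

end

section \<open>The criterion\<close>

text \<open>
  The property \<open>P\<close> lets a further almost-everywhere identity, such as agreement with a monotone
  representative, hold on all of the good set.
\<close>
lemma obtain_pointwise_solution:
  assumes sol: "self_similar p n a d \<beta> rv f" and zero: "zero_spectral_order n d \<beta> k" and rv: "\<not> rv k"
    and P: "AE x in unit_leb. P x"
  obtains E where "pointwise_solution n k a d \<beta> f E" "\<And>x. x \<in> E \<Longrightarrow> P x"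
proof -
  have n: "n > 1" and pos: "\<forall>i\<in>{1..n}. a i > 0" and total: "(\<Sum>i = 1..n. a i) = 1"
    and eq: "AE x in unit_leb. similarity_op n a d \<beta> rv f x = f x"
    using sol by (auto simp: self_similar_def)
  have k: "k \<in> {1..n}" and d0: "\<forall>j\<in>{1..n}. d j \<noteq> 0 \<longrightarrow> j = k"
    using zero by (auto simp: zero_spectral_order_def)
  define N where "N = {x \<in> {0..1}. \<not> (P x \<and> similarity_op n a d \<beta> rv f x = f x)}
    \<union> node a ` {1..n + 1} \<union> {node a k / (1 - a k)}"
  have "AE x in unit_leb. P x \<and> similarity_op n a d \<beta> rv f x = f x"
    using P eq by simp
  then have "negligible N"
    unfolding N_def AE_unit_leb_iff_negligible
    by (rule negligible_Un[OF negligible_Un])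
      (rule negligible_finite, intro finite_imageI finite_atLeastAtMost finite.intros)+
  moreover have ak: "a k \<noteq> 0" using pos k by force
  ultimately obtain M where M: "negligible M" "N \<subseteq> M"
    and inv: "\<And>x. (x - node a k) / a k \<in> M \<Longrightarrow> x \<in> M"
    using negligible_backward_invariant_hull by metis
  define E where "E = {0<..<1} - M"
  have ends: "node a 1 = 0" "node a (n + 1) = 1" using node_one node_last total by metis+
  have good: "P x \<and> similarity_op n a d \<beta> rv f x = f x" "\<forall>i\<in>{1..n+1}. x \<noteq> node a i"
    "x \<noteq> node a k / (1 - a k)" if "x \<in> E" for x
  proof -
    have "x \<in> {0..1}" "x \<notin> N" using that M(2) by (auto simp: E_def)
    then show "P x \<and> similarity_op n a d \<beta> rv f x = f x" "\<forall>i\<in>{1..n+1}. x \<noteq> node a i"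
      "x \<noteq> node a k / (1 - a k)"
      unfolding N_def by blast+
  qed
  note on_piece = similarity_op_on_piece[where a = a and d = d and \<beta> = \<beta> and f = f
    and rv = rv and k = k and n = n, OF pos _ k d0 rv]
  have "pointwise_solution n k a d \<beta> f E"
  proof
    show "AE x in unit_leb. x \<in> E"
    proof -
      have "{x \<in> {0..1}. x \<notin> E} \<subseteq> M \<union> {0, 1}" by (auto simp: E_def)
      moreover have "negligible (M \<union> {0, 1})" using M(1) by simp
      ultimately show ?thesis
        unfolding AE_unit_leb_iff_negligible using negligible_subset by blast
    qed
    show "\<exists>i\<in>{1..n}. x \<in> piece a i" if "x \<in> E" for x
      using piece_cover[of a x n] good(2)[OF that] ends that by (auto simp: E_def)
    show "f x = \<beta> i" if "x \<in> E" "i \<in> {1..n}" "i \<noteq> k" "x \<in> piece a i" for x i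
      using on_piece[OF that(2,4)] good(1)[OF that(1)] that(3)
      by simp
    show "f x = d k * f ((x - node a k) / a k) + \<beta> k" if "x \<in> E" "x \<in> piece a k" for x
      using on_piece[OF k that(2)] good(1)[OF that(1)] by simp
    show "(x - node a k) / a k \<in> E" if x: "x \<in> E" "x \<in> piece a k" for x
    proof -
      have "(x - node a k) / a k \<notin> M" using inv x(1) by (auto simp: E_def)
      moreover have "0 < a k" using pos k by auto
      ultimately show ?thesis
        using x(2) node_step[of k a] k by (auto simp: E_def field_simps)
    qed
    show "x \<noteq> node a k / (1 - a k)" if "x \<in> E" for x
      using good(3)[OF that] .
  qed (use n k pos total in \<open>auto simp: E_def\<close>)
  with good(1) that show ?thesis by blast
qed

lemma nondecreasing_iff_chain:
  assumes sol: "self_similar p n a d \<beta> rv f" and zero: "zero_spectral_order n d \<beta> k" and rv: "\<not> rv k"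
    and nonconst: "d k < 0 \<longrightarrow> \<not> (\<exists>c. AE x in unit_leb. f x = c)"
  shows "nondecreasing_Lp f \<longleftrightarrow> d k > 0 \<and> beta_chain (\<le>) n d \<beta> k"
proof
  assume "nondecreasing_Lp f"
  then obtain g where g: "AE x in unit_leb. f x = g x" "mono_on {0<..<1} g"
    by (auto simp: nondecreasing_Lp_def)
  obtain E where "pointwise_solution n k a d \<beta> f E" and agree: "\<And>x. x \<in> E \<Longrightarrow> f x = g x"
    using obtain_pointwise_solution[OF sol zero rv g(1)] by metis
  interpret pointwise_solution n k a d \<beta> f E by fact
  have "mono_on E f"
    using mono_on_subset[OF g(2) E] agree by (simp add: mono_on_def)
  moreover have "d k \<noteq> 0" using zero by (simp add: zero_spectral_order_def)
  ultimately show "d k > 0 \<and> beta_chain (\<le>) n d \<beta> k"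
    using factor_pos_if_mono nonconst chain_if_mono by blast
next
  assume chain: "d k > 0 \<and> beta_chain (\<le>) n d \<beta> k"
  obtain E where "pointwise_solution n k a d \<beta> f E"
    using obtain_pointwise_solution[OF sol zero rv, of "\<lambda>_. True"] by auto
  then interpret pointwise_solution n k a d \<beta> f E .
  show "nondecreasing_Lp f"
    using mono_on_full_measure_imp_nondecreasing[OF full E mono_on_if_chain] chain by blast
qed

lemma self_similar_uminus:
  assumes "self_similar p n a d \<beta> rv f"
  shows "self_similar p n a d (\<lambda>i. - \<beta> i) rv (\<lambda>x. - f x)"
proof -
  have "similarity_op n a d (\<lambda>i. - \<beta> i) rv (\<lambda>x. - f x) x = - similarity_op n a d \<beta> rv f x" for x
    unfolding similarity_op_def sum_negf[symmetric]
    by (intro sum.cong) (auto simp: piece_op_def piece_op_rev_def)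
  with assms show ?thesis
    by (auto simp: self_similar_def Lp_unit_def split: if_splits)
qed

lemma nonincreasing_iff_nondecreasing_uminus:
  "nonincreasing_Lp f \<longleftrightarrow> nondecreasing_Lp (\<lambda>x. - f x)"
proof
  assume "nonincreasing_Lp f"
  then obtain g where "AE x in unit_leb. f x = g x" "antimono_on {0<..<1} g"
    by (auto simp: nonincreasing_Lp_def)
  then show "nondecreasing_Lp (\<lambda>x. - f x)"
    unfolding nondecreasing_Lp_def
    by (intro exI[of _ "\<lambda>x. - g x"]) (auto simp: monotone_on_def)
next
  assume "nondecreasing_Lp (\<lambda>x. - f x)"
  then obtain g where "AE x in unit_leb. - f x = g x" "mono_on {0<..<1} g"
    by (auto simp: nondecreasing_Lp_def)
  then show "nonincreasing_Lp f"
    unfolding nonincreasing_Lp_def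
    by (intro exI[of _ "\<lambda>x. - g x"]) (auto simp: monotone_on_def)
qed

theorem theorem2p4:
  fixes p :: ennreal and n kh :: nat and a d \<beta> :: "nat \<Rightarrow> real"
    and rv :: "nat \<Rightarrow> bool" and f :: "real \<Rightarrow> real"
  assumes "1 \<le> p"
    and "self_similar p n a d \<beta> rv f"
    and "zero_spectral_order n d \<beta> kh"
    and "\<not> rv kh"
    and "d kh < 0 \<longrightarrow> \<not> (\<exists>c. AE x in lebesgue_on {0..1}. f x = c)"
  shows "(nondecreasing_Lp f \<longleftrightarrow> d kh > 0 \<and> beta_chain (\<le>) n d \<beta> kh) \<and>
    (nonincreasing_Lp f \<longleftrightarrow> d kh > 0 \<and> beta_chain (\<ge>) n d \<beta> kh)"
proof
  show "nondecreasing_Lp f \<longleftrightarrow> d kh > 0 \<and> beta_chain (\<le>) n d \<beta> kh"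
    using nondecreasing_iff_chain assms by blast
  have "zero_spectral_order n d (\<lambda>i. - \<beta> i) kh"
    using assms(3) by (simp add: zero_spectral_order_def)
  moreover have "d kh < 0 \<longrightarrow> \<not> (\<exists>c. AE x in unit_leb. - f x = c)"
  proof (intro impI notI)
    assume "d kh < 0" "\<exists>c. AE x in unit_leb. - f x = c"
    then obtain c where "AE x in unit_leb. - f x = c" by blast
    then have "AE x in unit_leb. f x = - c" by (rule eventually_mono) simp
    with assms(5) \<open>d kh < 0\<close> show False by blast
  qed
  ultimately show "nonincreasing_Lp f \<longleftrightarrow> d kh > 0 \<and> beta_chain (\<ge>) n d \<beta> kh"
    unfolding nonincreasing_iff_nondecreasing_uminus beta_chain_ge_iff_uminus
    using nondecreasing_iff_chain self_similar_uminus[OF assms(2)] assms(4) by blast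
qed

end
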